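(* Let $\Omega$ be a (one-dimensional, FLC, minimal) uniquely ergodic tiling space and let $F\in\mathcal F(\Omega)$. If $F$ is the time-one sampling of a uni-directional strongly pattern-equivariant flow on $\Omega$, and if $F$ has no fixed points, then the rotation class $[\mu]$ of $F$ exists; that is, there exists a rotation form $\mu$ for $F$.
   Context: Tilings: A tile is a pair $(I,\ell)$, with $I\subset\mathbb R$ a closed bounded interval of positive length and $\ell$ a label from a finite alphabet; tiles with the same label have the same length. $(I,\ell)-s=(I-s,\ell)$. A tiling $T$ is a collection of tiles meeting only at boundaries with union $\mathbb R$; $T-s$ is obtained by translating all tiles, and $\Gamma_s(T)=T-s$. (Such tilings have finite local complexity, FLC.) $d(T,T')$ is the infimum of the $\epsilon\in(0,1)$ for which there are $|s_1|,|s_2|\le\epsilon/2$ with $T-s_1$ and $T'-s_2$ agreeing exactly on $[-\epsilon^{-1},\epsilon^{-1}]$ ($1$ if there is none). $T$ is repetitive if for each finite pattern $P$ of $T$ there is $L_P$ such that every interval of length $L_P$ in $T$ contains a copy of $P$. A tiling space $\Omega$ is the closure of the translation orbit $\{T-s\}$ of a repetitive non-periodic tiling; it is compact, minimal under $\Gamma$, and its path components are the translation orbits. Uniquely ergodic means that $(\Omega,\Gamma)$ has a unique invariant probability measure. The orbit of a reference tiling $T\in\Omega$ is identified with $\mathbb R$ by $T-x\leftrightarrow x$. Pattern equivariance: A continuous $\phi:\mathbb R\to\mathbb R$ is pattern equivariant with radius $R$ with respect to $T$ if $\phi(x_1)=\phi(x_2)$ whenever $T-x_1$ and $T-x_2$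 agree exactly on $[-R,R]$; it is strongly pattern equivariant (sPE) if this holds for some $R>0$. A continuous function $G:\Omega\to\mathbb R$ is sPE if $x\mapsto G(T-x)$ is sPE with respect to $T$ (for one, equivalently every, $T\in\Omega$). An sPE 1-form with respect to $T$ is $g(x)\,dx$ with $g$ sPE. Maps: $\mathcal F(\Omega)$ is the set of homeomorphisms $F:\Omega\to\Omega$, homotopic to the identity, such that the displacement $\Phi:\Omega\to\mathbb R$, defined by $F(T)=T-\Phi(T)$, is sPE. For a reference tiling $T$, $f=f_T:\mathbb R\to\mathbb R$ is given by $F(T-x)=T-f_T(x)$, so $f_T(x)=x+\Phi(T-x)$. Rotation forms: An sPE 1-form $\mu$ (with respect to a reference tiling $T$) is a rotation form for $F$ if there is $R$ such that, for all $x_1,x_2\in\mathbb R$ for which $T-x_1$ and $T-x_2$ agree on the ball of radius $R$ about the origin, and all integers $n_\pm$ with $n_-<\int_{x_1}^{x_2}\mu<n_+$, the point $x_2$ is strictly between $f_T^{n_-}(x_1)$ and $f_T^{n_+}(x_1)$. Two sPE 1-forms are cohomologous if they differ by $dg$ with $g$ sPE; a form cohomologous to a rotation form is a rotation form, and its class $[\mu]\in \check H^1(\Omega,\mathbb R)\cong\{\text{sPE 1-forms}\}/d\{\text{sPE functions}\}$ is called a rotation class. Flows: A flow with sPE velocity is a continuous $\bar F:\Omega\times\mathbb R\to\Omega$ for which there is an sPE $V:\Omega\to\mathbb R$ with $\bar F(T,t)=T-x_T(t)$, $x_T(0)=0$, $\frac{dx_T}{dt}=V(T-x_T(t))$. It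 is uni-directional if $V$ has no zeros. $F$ is its time-one sampling if $F(T)=\bar F(T,1)$. *)

theory Defs
  imports "HOL-Probability.Probability"
begin

section \<open>Tilings of the real line\<close>

type_synonym 'a tile = "real set \<times> 'a"

definition is_tile :: "'a tile \<Rightarrow> bool" where
  "is_tile t \<longleftrightarrow> (\<exists>a b. a < b \<and> fst t = {a..b})"

definition tiling :: "'a::finite tile set \<Rightarrow> bool" where
  "tiling T \<longleftrightarrow>
     (\<forall>t\<in>T. is_tile t) \<and>
     (\<forall>t\<in>T. \<forall>u\<in>T. snd t = snd u \<longrightarrow> measure lborel (fst t) = measure lborel (fst u)) \<and>
     (\<forall>t\<in>T. \<forall>u\<in>T. t \<noteq> u \<longrightarrow> fst t \<inter> fst u \<subseteq> frontier (fst t) \<inter> frontier (fst u)) \<and>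
     (\<Union>t\<in>T. fst t) = UNIV"

text \<open>\<open>translate T s\<close> is \<open>T - s\<close>, so tiles move to the left when \<open>s > 0\<close>. It is also applied to patterns,
  i.e. finite sets of tiles.\<close>

definition translate :: "'a tile set \<Rightarrow> real \<Rightarrow> 'a tile set" where
  "translate T s = (\<lambda>(I, l). ((\<lambda>x. x - s) ` I, l)) ` T"

text \<open>Exact agreement on \<open>K\<close> means that the same (whole) tiles meet \<open>K\<close>. Comparing only
  the parts of the tiles inside \<open>K\<close> would change radii by at most the largest tile length.\<close>

definition agree_on :: "real set \<Rightarrow> 'a tile set \<Rightarrow> 'a tile set \<Rightarrow> bool" where
  "agree_on K T T' \<longleftrightarrow> {t \<in> T. fst t \<inter> K \<noteq> {}} = {t \<in> T'. fst t \<inter> K \<noteq> {}}"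

definition near :: "real \<Rightarrow> 'a tile set \<Rightarrow> 'a tile set \<Rightarrow> bool" where
  "near \<epsilon> T T' \<longleftrightarrow> 0 < \<epsilon> \<and> \<epsilon> < 1 \<and>
     (\<exists>s1 s2. \<bar>s1\<bar> \<le> \<epsilon> / 2 \<and> \<bar>s2\<bar> \<le> \<epsilon> / 2 \<and>
        agree_on {- inverse \<epsilon> .. inverse \<epsilon>} (translate T s1) (translate T' s2))"

definition tdist :: "'a tile set \<Rightarrow> 'a tile set \<Rightarrow> real" where
  "tdist T T' = Inf (insert 1 {\<epsilon>. near \<epsilon> T T'})"

lemma translate_0 [simp]: "translate T 0 = T"
  by (simp add: translate_def case_prod_unfold)

lemma translate_translate [simp]: "translate (translate T s) r = translate T (s + r)"
  by (simp add: translate_def image_image case_prod_unfold algebra_simps)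

lemma mem_translate_iff: "(I, l) \<in> translate T s \<longleftrightarrow> ((\<lambda>x. x + s) ` I, l) \<in> T"
proof
  assume "(I, l) \<in> translate T s"
  then show "((\<lambda>x. x + s) ` I, l) \<in> T"
    by (auto simp: translate_def image_image)
next
  assume "((\<lambda>x. x + s) ` I, l) \<in> T"
  moreover have "I = (\<lambda>x. x - s) ` ((\<lambda>x. x + s) ` I)"
    by (auto simp: image_image)
  ultimately show "(I, l) \<in> translate T s"
    unfolding translate_def by (force simp: image_iff)
qed

lemma agree_on_iff:
  "agree_on K T T' \<longleftrightarrow> (\<forall>I l. I \<inter> K \<noteq> {} \<longrightarrow> (I, l) \<in> T \<longleftrightarrow> (I, l) \<in> T')"
  unfolding agree_on_def set_eq_iff by auto

lemma agree_on_refl [simp]: "agree_on K T T"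
  by (simp add: agree_on_def)

lemma agree_on_sym: "agree_on K T T' \<Longrightarrow> agree_on K T' T"
  by (simp add: agree_on_def)

lemma agree_on_trans: "agree_on K T T' \<Longrightarrow> agree_on K T' T'' \<Longrightarrow> agree_on K T T''"
  by (simp add: agree_on_def)

lemma agree_on_mono: "agree_on K T T' \<Longrightarrow> K' \<subseteq> K \<Longrightarrow> agree_on K' T T'"
  unfolding agree_on_iff by (metis Int_mono order_refl subset_empty)

lemma agree_on_translate:
  assumes "agree_on K T T'" and "(\<lambda>x. x + s) ` K' \<subseteq> K"
  shows "agree_on K' (translate T s) (translate T' s)"
  unfolding agree_on_iff mem_translate_iff
proof (intro allI impI)
  fix I :: "real set" and l
  assume "I \<inter> K' \<noteq> {}"
  then have "(\<lambda>x. x + s) ` I \<inter> K \<noteq> {}" using assms(2) by blast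
  with assms(1)[unfolded agree_on_iff, rule_format]
  show "((\<lambda>x. x + s) ` I, l) \<in> T \<longleftrightarrow> ((\<lambda>x. x + s) ` I, l) \<in> T'" .
qed

lemma near_bdd: "bdd_below {\<epsilon>. near \<epsilon> T T'}"
  by (rule bdd_belowI[of _ 0]) (auto simp: near_def)

lemma tdist_le: "near \<epsilon> T T' \<Longrightarrow> tdist T T' \<le> \<epsilon>"
  unfolding tdist_def by (rule cInf_lower) (auto simp: near_bdd)

lemma tdist_le_1: "tdist T T' \<le> 1"
  unfolding tdist_def by (rule cInf_lower) (auto simp: near_bdd)

lemma tdist_nonneg: "0 \<le> tdist T T'"
  unfolding tdist_def by (rule cInf_greatest) (auto simp: near_def)

lemma tdist_less: 
  assumes "tdist T T' < e" "e \<le> 1" obtains \<epsilon> where "\<epsilon> < e" "near \<epsilon> T T'"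
proof -
  have "\<exists>x\<in>insert 1 {\<epsilon>. near \<epsilon> T T'}. x < e"
    using assms(1) unfolding tdist_def by (subst (asm) cInf_less_iff) (auto simp: near_bdd)
  then show thesis using assms(2) that by auto
qed

lemma near_sym: "near \<epsilon> T T' \<Longrightarrow> near \<epsilon> T' T"
  unfolding near_def using agree_on_sym by blast

lemma tdist_sym: "tdist T T' = tdist T' T"
proof -
  have "{\<epsilon>. near \<epsilon> T T'} = {\<epsilon>. near \<epsilon> T' T}"
    using near_sym[of _ T T'] near_sym[of _ T' T] by blast
  then show ?thesis by (simp only: tdist_def)
qed

lemma near_trans:
  assumes "near a T T'" "near b T' T''" "a + b < 1"
  shows "near (a + b) T T''"
proof -
  obtain s1 s2 where s: "\<bar>s1\<bar> \<le> a / 2" "\<bar>s2\<bar> \<le> a / 2"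
    and A: "agree_on {- inverse a .. inverse a} (translate T s1) (translate T' s2)"
    using assms(1) unfolding near_def by blast
  obtain s3 s4 where r: "\<bar>s3\<bar> \<le> b / 2" "\<bar>s4\<bar> \<le> b / 2"
    and B: "agree_on {- inverse b .. inverse b} (translate T' s3) (translate T'' s4)"
    using assms(2) unfolding near_def by blast
  have ab: "0 < a" "0 < b" using assms by (auto simp: near_def)
  have ia: "inverse a - inverse (a + b) \<ge> b / 2" and ib: "inverse b - inverse (a + b) \<ge> a / 2"
  proof -
    have gen: "inverse x - inverse (x + y) \<ge> y / 2" if "0 < x" "0 < y" "x + y < 1" for x y :: real
    proof -
      have "x * (x + y) \<le> 1 * 1" using that by (intro mult_mono) auto
      then have "y * (x * (x + y)) \<le> y * 2" using that by (intro mult_left_mono) auto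
      then have "y / 2 \<le> y / (x * (x + y))" using that by (simp add: divide_simps)
      also have "\<dots> = inverse x - inverse (x + y)" using that by (simp add: divide_simps)
      finally show ?thesis .
    qed
    show "inverse a - inverse (a + b) \<ge> b / 2" using gen ab assms(3) by blast
    show "inverse b - inverse (a + b) \<ge> a / 2" using gen[of b a] ab assms(3) by (simp add: add.commute)
  qed
  define K where "K = {- inverse (a + b) .. inverse (a + b)}"
  have "(\<lambda>x. x + s3) ` K \<subseteq> {- inverse a .. inverse a}"
    unfolding K_def by (rule image_subsetI) (use ia r in auto)
  from agree_on_translate[OF A this]
  have 1: "agree_on K (translate T (s1 + s3)) (translate T' (s2 + s3))" by simp
  have "(\<lambda>x. x + s2) ` K \<subseteq> {- inverse b .. inverse b}"
    unfolding K_def by (rule image_subsetI) (use ib s in auto)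
  from agree_on_translate[OF B this]
  have 2: "agree_on K (translate T' (s2 + s3)) (translate T'' (s2 + s4))"
    by (simp add: add.commute)
  have "\<bar>s1 + s3\<bar> \<le> (a + b) / 2" "\<bar>s2 + s4\<bar> \<le> (a + b) / 2"
    using s r abs_triangle_ineq[of s1 s3] abs_triangle_ineq[of s2 s4]
    unfolding add_divide_distrib by linarith+
  then show ?thesis
    unfolding near_def using agree_on_trans[OF 1 2, unfolded K_def] ab assms(3) by auto
qed

lemma tdist_triangle: "tdist T T'' \<le> tdist T T' + tdist T' T''"
proof (rule field_le_epsilon)
  fix e :: real assume e: "0 < e"
  show "tdist T T'' \<le> tdist T T' + tdist T' T'' + e"
  proof (cases "tdist T T' + tdist T' T'' + e < 1")
    case True
    obtain a where a: "a < tdist T T' + e / 2" "near a T T'"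
      using tdist_less[of T T' "tdist T T' + e / 2"] True e tdist_nonneg[of T' T''] by auto
    obtain b where b: "b < tdist T' T'' + e / 2" "near b T' T''"
      using tdist_less[of T' T'' "tdist T' T'' + e / 2"] True e tdist_nonneg[of T T'] by auto
    show ?thesis using tdist_le[OF near_trans[OF a(2) b(2)]] a(1) b(1) True by linarith
  next
    case False
    then show ?thesis using tdist_le_1[of T T''] by linarith
  qed
qed

lemma tdist_refl: "tdist T T = 0"
proof (rule antisym[OF _ tdist_nonneg], rule field_le_epsilon)
  fix e :: real assume "0 < e"
  have "near (min e (1/2)) T T" unfolding near_def
    by (intro conjI exI[of _ 0]) (use \<open>0 < e\<close> in auto)
  from tdist_le[OF this] show "tdist T T \<le> 0 + e" by auto
qed

lemma tdist_0_subset: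
  assumes T: "tiling T" and T': "tiling T'" and d: "tdist T T' = 0"
  shows "T \<subseteq> T'"
proof
  fix t assume t: "t \<in> T"
  obtain I l where tI: "t = (I, l)" by force
  obtain a b where ab: "a < b" "I = {a..b}"
    using T t tI unfolding tiling_def is_tile_def by fastforce
  have cl: "\<exists>u. \<bar>u\<bar> < e \<and> ({a + u..b + u}, l) \<in> T'" if e: "0 < e" for e
  proof -
    define e' where "e' = min (min e 1) (1 / (\<bar>a\<bar> + 1))"
    have e': "0 < e'" "e' \<le> 1" "e' \<le> e" "e' \<le> 1 / (\<bar>a\<bar> + 1)" using e by (auto simp: e'_def)
    obtain c where c: "c < e'" "near c T T'" using tdist_less[of T T' e'] d e' by auto
    obtain s1 s2 where s: "\<bar>s1\<bar> \<le> c / 2" "\<bar>s2\<bar> \<le> c / 2"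
      and A: "agree_on {- inverse c .. inverse c} (translate T s1) (translate T' s2)"
      using c(2) unfolding near_def by blast
    have c0: "0 < c" "c < 1" using c(2) by (auto simp: near_def)
    have "inverse c > \<bar>a\<bar> + 1" using c(1) e'(4) c0
      by (smt (verit) inverse_eq_divide inverse_inverse_eq less_imp_inverse_less)
    then have "a - s1 \<in> {a - s1..b - s1} \<inter> {- inverse c .. inverse c}" using s c0 ab by auto
    then have ne: "{a - s1..b - s1} \<inter> {- inverse c .. inverse c} \<noteq> {}" by blast
    have im: "(\<lambda>x. x + r) ` {p..q} = {p + r..q + r}" for p q r :: real
      using image_add_atLeastAtMost'[of r p q] by simp
    have "({a - s1..b - s1}, l) \<in> translate T s1"
      unfolding mem_translate_iff im using t tI ab by simp
    then have "({a - s1..b - s1}, l) \<in> translate T' s2"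
      using A[unfolded agree_on_iff, rule_format, OF ne] by simp
    then have "({a + (s2 - s1)..b + (s2 - s1)}, l) \<in> T'"
      unfolding mem_translate_iff im by (simp add: algebra_simps)
    moreover have "\<bar>s2 - s1\<bar> < e" using s c(1) e'(3) by linarith
    ultimately show ?thesis by blast
  qed
  obtain u where u: "\<bar>u\<bar> < (b - a) / 2" "({a + u..b + u}, l) \<in> T'"
    using cl[of "(b - a) / 2"] ab by auto
  have "u = 0"
  proof (rule ccontr)
    assume "u \<noteq> 0"
    then obtain v where v: "\<bar>v\<bar> < \<bar>u\<bar>" "({a + v..b + v}, l) \<in> T'"
      using cl[of "\<bar>u\<bar>"] by auto
    have ne: "{a + u..b + u} \<noteq> {a + v..b + v}" using v(1) ab by (auto simp: Icc_eq_Icc)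
    have "(({a + u..b + u}, l) :: 'a tile) \<noteq> ({a + v..b + v}, l)" using ne by simp
    then have sub: "{a + u..b + u} \<inter> {a + v..b + v} \<subseteq> frontier {a + u..b + u}"
      using T' u(2) v(2) unfolding tiling_def by fastforce
    have "(a + b) / 2 \<in> {a + u..b + u} \<inter> {a + v..b + v}"
      unfolding Int_iff atLeastAtMost_iff
      by (intro conjI; use u(1) v(1) ab in \<open>simp add: field_simps abs_if split: if_splits\<close>)
    then have "(a + b) / 2 \<in> frontier {a + u..b + u}" using sub by blast
    moreover have "(a + b) / 2 \<in> interior {a + u..b + u}"
      using u(1) ab by (auto simp: field_simps abs_less_iff)
    ultimately show False by (simp add: frontier_def)
  qed
  then show "t \<in> T'" using u(2) tI ab by simp
qed

lemma Metric_space_tdist: "Metric_space {T. tiling T} tdist"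
proof
  fix T T' T'' :: "'a tile set"
  show "0 \<le> tdist T T'" by (rule tdist_nonneg)
  show "tdist T T' = tdist T' T" by (rule tdist_sym)
  show "tdist T T'' \<le> tdist T T' + tdist T' T''" by (rule tdist_triangle)
  assume "T \<in> {T. tiling T}" "T' \<in> {T. tiling T}"
  then show "(tdist T T' = 0) = (T = T')"
    using tdist_0_subset[of T T'] tdist_0_subset[of T' T] tdist_sym[of T T'] tdist_refl[of T] by auto
qed

abbreviation tiling_top :: "'a::finite tile set set \<Rightarrow> 'a tile set topology" where
  "tiling_top \<Omega> \<equiv> Metric_space.mtopology \<Omega> tdist"

definition repetitive :: "'a tile set \<Rightarrow> bool" where
  "repetitive T \<longleftrightarrow>
     (\<forall>P. finite P \<and> P \<subseteq> T \<longrightarrow>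
       (\<exists>L>0. \<forall>a. \<exists>s. translate P s \<subseteq> T \<and> (\<forall>t\<in>translate P s. fst t \<subseteq> {a..a + L})))"

definition periodic :: "'a tile set \<Rightarrow> bool" where
  "periodic T \<longleftrightarrow> (\<exists>p. p \<noteq> 0 \<and> translate T p = T)"

text \<open>The closure is taken among all tilings with labels in \<open>'a\<close>. Tilings in it are locally
  translates of patches of \<open>T\<close>, so they have the same tile lengths as \<open>T\<close>.\<close>

definition tiling_space :: "'a::finite tile set set \<Rightarrow> bool" where
  "tiling_space \<Omega> \<longleftrightarrow>
     (\<exists>T. tiling T \<and> repetitive T \<and> \<not> periodic T \<and>
          \<Omega> = tiling_top {T'. tiling T'} closure_of (range (translate T)))"

definition invariant_prob :: "'a::finite tile set set \<Rightarrow> 'a tile set measure \<Rightarrow> bool" where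
  "invariant_prob \<Omega> M \<longleftrightarrow>
     prob_space M \<and> space M = \<Omega> \<and>
     sets M = sigma_sets \<Omega> {U. openin (tiling_top \<Omega>) U} \<and>
     (\<forall>s. \<forall>A\<in>sets M. emeasure M {T\<in>\<Omega>. translate T s \<in> A} = emeasure M A)"

definition uniquely_ergodic :: "'a::finite tile set set \<Rightarrow> bool" where
  "uniquely_ergodic \<Omega> \<longleftrightarrow> (\<exists>!M. invariant_prob \<Omega> M)"


section \<open>Pattern equivariance\<close>

definition sPE :: "'a tile set \<Rightarrow> (real \<Rightarrow> real) \<Rightarrow> bool" where
  "sPE T \<phi> \<longleftrightarrow> continuous_on UNIV \<phi> \<and>
     (\<exists>R>0. \<forall>x1 x2. agree_on {-R..R} (translate T x1) (translate T x2) \<longrightarrow> \<phi> x1 = \<phi> x2)"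

definition sPE_on :: "'a::finite tile set set \<Rightarrow> ('a tile set \<Rightarrow> real) \<Rightarrow> bool" where
  "sPE_on \<Omega> G \<longleftrightarrow> continuous_map (tiling_top \<Omega>) euclideanreal G \<and>
     (\<forall>T\<in>\<Omega>. sPE T (\<lambda>x. G (translate T x)))"


section \<open>Maps with strongly pattern equivariant displacement\<close>

text \<open>Elements of a tiling space are non-periodic, so at most one \<open>s\<close> satisfies
  \<open>F T = translate T s\<close>.\<close>

definition displacement :: "('a tile set \<Rightarrow> 'a tile set) \<Rightarrow> 'a tile set \<Rightarrow> real" where
  "displacement F T = (THE s. F T = translate T s)"

definition sPE_homeos :: "'a::finite tile set set \<Rightarrow> ('a tile set \<Rightarrow> 'a tile set) set" where
  "sPE_homeos \<Omega> = {F.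
     homeomorphic_map (tiling_top \<Omega>) (tiling_top \<Omega>) F \<and>
     homotopic_with (\<lambda>_. True) (tiling_top \<Omega>) (tiling_top \<Omega>) F id \<and>
     (\<forall>T\<in>\<Omega>. F T = translate T (displacement F T)) \<and>
     sPE_on \<Omega> (displacement F)}"

definition orbit_map :: "('a tile set \<Rightarrow> 'a tile set) \<Rightarrow> 'a tile set \<Rightarrow> real \<Rightarrow> real" where
  "orbit_map F T x = x + displacement F (translate T x)"

definition int_iterate :: "('b \<Rightarrow> 'b) \<Rightarrow> int \<Rightarrow> 'b \<Rightarrow> 'b" where
  "int_iterate f n = (if 0 \<le> n then f ^^ nat n else inv f ^^ nat (- n))"

definition strictly_between :: "real \<Rightarrow> real \<Rightarrow> real \<Rightarrow> bool" where
  "strictly_between y a b \<longleftrightarrow> a < y \<and> y < b \<or> b < y \<and> y < a"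

text \<open>The 1-form \<open>g(x) dx\<close> is represented by its density \<open>g\<close>; the integral below is
  oriented.\<close>

definition rotation_form ::
    "('a tile set \<Rightarrow> 'a tile set) \<Rightarrow> 'a tile set \<Rightarrow> (real \<Rightarrow> real) \<Rightarrow> bool" where
  "rotation_form F T g \<longleftrightarrow> sPE T g \<and>
     (\<exists>R>0. \<forall>x1 x2. agree_on {-R..R} (translate T x1) (translate T x2) \<longrightarrow>
        (\<forall>m n. real_of_int m < (LBINT x=ereal x1..ereal x2. g x) \<and>
               (LBINT x=ereal x1..ereal x2. g x) < real_of_int n \<longrightarrow>
           strictly_between x2 (int_iterate (orbit_map F T) m x1)
                               (int_iterate (orbit_map F T) n x1)))"


section \<open>Flows with strongly pattern equivariant velocity\<close>

definition sPE_flow ::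
    "'a::finite tile set set \<Rightarrow> ('a tile set \<times> real \<Rightarrow> 'a tile set) \<Rightarrow> ('a tile set \<Rightarrow> real) \<Rightarrow> bool"
  where
  "sPE_flow \<Omega> Fbar V \<longleftrightarrow>
     continuous_map (prod_topology (tiling_top \<Omega>) euclideanreal) (tiling_top \<Omega>) Fbar \<and>
     sPE_on \<Omega> V \<and>
     (\<exists>x. \<forall>T\<in>\<Omega>. x T 0 = 0 \<and>
        (\<forall>t. Fbar (T, t) = translate T (x T t) \<and>
             (x T has_real_derivative V (translate T (x T t))) (at t)))"

definition unidirectional :: "'a tile set set \<Rightarrow> ('a tile set \<Rightarrow> real) \<Rightarrow> bool" where
  "unidirectional \<Omega> V \<longleftrightarrow> (\<forall>T\<in>\<Omega>. V T \<noteq> 0)"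

definition time_one_sampling ::
    "'a tile set set \<Rightarrow> ('a tile set \<Rightarrow> 'a tile set) \<Rightarrow> ('a tile set \<times> real \<Rightarrow> 'a tile set) \<Rightarrow> bool"
  where
  "time_one_sampling \<Omega> F Fbar \<longleftrightarrow> (\<forall>T\<in>\<Omega>. F T = Fbar (T, 1))"

end

(* The rotation form is the time form dx / V of the flow: integrated between two points of the
   orbit of T, it gives the time that the flow needs to go from one to the other. Hence its
   primitive H conjugates the orbit map to the unit translation, and as H is strictly monotone, the
   betweenness condition holds for arbitrary x1 and x2, whether or not the patterns agree there.
   Elements of the tiling space being non-periodic, the displacement of F is the displacement of
   the flow at time 1. *)

theory Submission imports Defs begin

section \<open>Translates of tilings\<close>

lemma image_minus_Icc: "(\<lambda>x. x - s) ` {a..b} = {a - s..b - (s::real)}"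
  using image_add_atLeastAtMost'[of "- s" a b] by simp

lemma translate_mono: "P \<subseteq> Q \<Longrightarrow> translate P s \<subseteq> translate Q s"
  unfolding translate_def by (rule image_mono)

lemma tiling_cover:
  assumes "tiling T"
  obtains t where "t \<in> T" "x \<in> fst t"
proof -
  have "(\<Union>t\<in>T. fst t) = UNIV" using assms unfolding tiling_def by (elim conjE)
  then show thesis using that by (metis UN_iff UNIV_I)
qed

lemma tiling_tileE:
  assumes "tiling T" "(I, l) \<in> T"
  obtains a b where "a < b" "I = {a..b}"
  using assms unfolding tiling_def is_tile_def by fastforce

lemma mem_translateE:
  assumes "tiling T" "t \<in> translate T s"
  obtains a b l where "a < b" "t = ({a - s..b - s}, l)" "({a..b}, l) \<in> T"
proof -
  obtain I l where I: "(I, l) \<in> T" "t = ((\<lambda>x. x - s) ` I, l)"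
    using assms(2) unfolding translate_def by auto
  moreover obtain a b where "a < b" "I = {a..b}"
    using tiling_tileE[OF assms(1) I(1)] .
  ultimately show thesis using that I by (simp add: image_minus_Icc)
qed

text \<open>The boundary condition on overlaps becomes a uniqueness principle: one interior point
  suffices to identify a tile.\<close>

lemma tiling_meet_interior:
  assumes "tiling T" "({a..b}, l) \<in> T" "u \<in> T" "a < x" "x < b" "x \<in> fst u"
  shows "u = ({a..b}, l)"
proof (rule ccontr)
  assume "u \<noteq> ({a..b}, l)"
  then have "fst u \<inter> {a..b} \<subseteq> frontier {a..b}"
    using assms(1-3) unfolding tiling_def by fastforce
  then show False using assms(4-6) by (auto simp: frontier_def)
qed

lemma tiling_translate:
  assumes T: "tiling T"
  shows "tiling (translate T s)"
  unfolding tiling_def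
proof (intro conjI ballI impI)
  fix t assume t: "t \<in> translate T s"
  from mem_translateE[OF T t] obtain a b l
    where "a < b" "t = ({a - s..b - s}, l)" "({a..b}, l) \<in> T" .
  then have "a - s < b - s" "fst t = {a - s..b - s}" by auto
  then show "is_tile t" unfolding is_tile_def by blast
next
  fix t u assume t: "t \<in> translate T s" and u: "u \<in> translate T s"
  from mem_translateE[OF T t] obtain a b l
    where 1: "a < b" "t = ({a - s..b - s}, l)" "({a..b}, l) \<in> T" .
  from mem_translateE[OF T u] obtain c d k
    where 2: "c < d" "u = ({c - s..d - s}, k)" "({c..d}, k) \<in> T" .
  {
    assume "snd t = snd u"
    then have "measure lborel {a..b} = measure lborel {c..d}"
      using T 1 2 unfolding tiling_def by (metis fst_conv snd_conv)
    then show "measure lborel (fst t) = measure lborel (fst u)"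
      using 1 2 by simp
  next
    assume "t \<noteq> u"
    then have ne: "({a..b}, l) \<noteq> ({c..d}, k)" using 1 2 by auto
    show "fst t \<inter> fst u \<subseteq> frontier (fst t) \<inter> frontier (fst u)"
    proof
      fix x assume x: "x \<in> fst t \<inter> fst u"
      \<comment> \<open>Shifted back by \<open>s\<close>, a common point of two distinct tiles can
        be interior to neither of them, so it is an endpoint of both.\<close>
      have xs: "x + s \<in> {a..b}" "x + s \<in> {c..d}" using x 1(2) 2(2) by auto
      have "\<not> (a < x + s \<and> x + s < b)"
        using tiling_meet_interior[OF T 1(3) 2(3), of "x + s"] ne xs(2) by (metis fst_conv)
      moreover have "\<not> (c < x + s \<and> x + s < d)"
        using tiling_meet_interior[OF T 2(3) 1(3), of "x + s"] ne xs(1) by (metis fst_conv)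
      ultimately have "x = a - s \<or> x = b - s" "x = c - s \<or> x = d - s"
        using xs by (auto simp: less_le)
      moreover have "frontier {a - s..b - s} = {a - s, b - s}" "frontier {c - s..d - s} = {c - s, d - s}"
        using 1(1) 2(1) by (auto simp: frontier_def)
      ultimately show "x \<in> frontier (fst t) \<inter> frontier (fst u)"
        unfolding 1(2) 2(2) fst_conv by blast
    qed
  }
next
  have "\<exists>t\<in>translate T s. x \<in> fst t" for x
  proof -
    obtain t where t: "t \<in> T" "x + s \<in> fst t" using tiling_cover[OF T] .
    have "((\<lambda>y. y - s) ` fst t, snd t) \<in> translate T s"
      unfolding translate_def case_prod_unfold using t(1) by (rule imageI)
    moreover have "x \<in> (\<lambda>y. y - s) ` fst t" using imageI[OF t(2), of "\<lambda>y. y - s"] by simp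
    ultimately show ?thesis by (metis fst_conv)
  qed
  then show "(\<Union>t\<in>translate T s. fst t) = UNIV" by blast
qed

section \<open>Tiling spaces as orbit closures\<close>

text \<open>The small translations allowed by the metric can be absorbed into the orbit parameter.\<close>

lemma mem_orbit_closure_iff:
  assumes T0: "tiling T0"
  shows "T \<in> tiling_top {T'. tiling T'} closure_of (range (translate T0)) \<longleftrightarrow>
    tiling T \<and> (\<forall>R. \<exists>s. agree_on {-R..R} T (translate T0 s))"
    (is "_ \<longleftrightarrow> _ \<and> ?A")
proof -
  interpret Metric_space "{T::'a tile set. tiling T}" tdist by (rule Metric_space_tdist)
  have "T \<in> mtopology closure_of (range (translate T0)) \<longleftrightarrow>
      tiling T \<and> (\<forall>r>0. \<exists>s. tdist T (translate T0 s) < r)"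
    unfolding metric_closure_of using tiling_translate[OF T0] by (auto simp: in_mball)
  moreover have "(\<forall>r>0. \<exists>s. tdist T (translate T0 s) < r) \<longleftrightarrow> ?A"
  proof (intro iffI allI impI)
    fix R :: real
    assume A: "\<forall>r>0. \<exists>s. tdist T (translate T0 s) < r"
    \<comment> \<open>Distance below \<open>r\<close> yields agreement on a window of radius at
      least |R| + 1. The extra 1 leaves room to undo the shift \<open>u\<close>, which is smaller
      than 1/2, and so to return to \<open>T\<close> itself.\<close>
    define r where "r = inverse (\<bar>R\<bar> + 1)"
    have r: "0 < r" "r \<le> 1" "inverse r = \<bar>R\<bar> + 1" by (auto simp: r_def field_simps)
    obtain s where s: "tdist T (translate T0 s) < r" using A r(1) by blast
    from tdist_less[OF s r(2)] obtain c where c: "c < r" "near c T (translate T0 s)" .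
    then obtain u w where u: "0 < c" "c < 1" "\<bar>u\<bar> \<le> c / 2" "\<bar>w\<bar> \<le> c / 2"
      and B: "agree_on {- inverse c .. inverse c} (translate T u) (translate (translate T0 s) w)"
      unfolding near_def by blast
    have "\<bar>R\<bar> + 1 \<le> inverse c" using c(1) u(1) r(3) by (metis le_imp_inverse_le less_imp_le)
    then have "(\<lambda>x. x + - u) ` {-R..R} \<subseteq> {- inverse c .. inverse c}" using u by auto
    from agree_on_translate[OF B this]
    show "\<exists>s. agree_on {-R..R} T (translate T0 s)" by auto
  next
    fix r :: real
    assume A: ?A and r: "0 < r"
    \<comment> \<open>\<open>near\<close> asks for \<open>c < 1\<close>, and the resulting bound
      \<open>tdist \<le> c\<close> has to be strictly below \<open>r\<close>. Both shifts in
      \<open>near\<close> are taken to be 0.\<close>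
    define c where "c = min (r / 2) (1 / 2)"
    have c: "0 < c" "c < 1" "c < r" using r by (auto simp: c_def)
    obtain s where "agree_on {- inverse c..inverse c} T (translate T0 s)" using A by blast
    then have "near c T (translate T0 s)"
      unfolding near_def using c by (intro conjI exI[of _ 0]) auto
    from tdist_le[OF this] show "\<exists>s. tdist T (translate T0 s) < r"
      using c(3) by (intro exI[of _ s]) simp
  qed
  ultimately show ?thesis by simp
qed

text \<open>Removes the metric: membership in the space means that every window of \<open>T\<close>
  is seen somewhere in \<open>T0\<close>.\<close>

lemma tiling_spaceE:
  assumes "tiling_space \<Omega>"
  obtains T0 where "tiling T0" "repetitive T0" "\<not> periodic T0"
    "\<Omega> = {T. tiling T \<and> (\<forall>R. \<exists>s. agree_on {-R..R} T (translate T0 s))}"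
proof -
  from assms show thesis
    unfolding tiling_space_def
  proof (elim exE conjE)
    fix T0 assume T0: "tiling T0" "repetitive T0" "\<not> periodic T0"
      and \<Omega>: "\<Omega> = tiling_top {T'. tiling T'} closure_of (range (translate T0))"
    show thesis
      by (rule that[OF T0], rule set_eqI) (unfold \<Omega> mem_orbit_closure_iff[OF T0(1)] mem_Collect_eq, rule refl)
  qed
qed

lemma tiling_space_translate:
  assumes "tiling_space \<Omega>" "T \<in> \<Omega>"
  shows "translate T s \<in> \<Omega>"
proof -
  from tiling_spaceE[OF assms(1)] obtain T0 where
    \<Omega>: "\<Omega> = {T. tiling T \<and> (\<forall>R. \<exists>s. agree_on {-R..R} T (translate T0 s))}" .
  have T: "tiling T" "\<And>R. \<exists>s. agree_on {-R..R} T (translate T0 s)"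
    using assms(2)[unfolded \<Omega>] by blast+
  have "\<exists>r. agree_on {-R..R} (translate T s) (translate T0 r)" for R
  proof -
    \<comment> \<open>The window is enlarged by |s| so that it still covers [-R, R] after
      translation by \<open>s\<close>.\<close>
    obtain q where q: "agree_on {-(\<bar>R\<bar> + \<bar>s\<bar>)..\<bar>R\<bar> + \<bar>s\<bar>} T (translate T0 q)" using T(2) by blast
    have "(\<lambda>x. x + s) ` {-R..R} \<subseteq> {-(\<bar>R\<bar> + \<bar>s\<bar>)..\<bar>R\<bar> + \<bar>s\<bar>}" by auto
    from agree_on_translate[OF q this] show ?thesis by auto
  qed
  then show ?thesis
    unfolding \<Omega> using tiling_translate[OF T(1)] by simp
qed

text \<open>By repetitivity every finite patch of \<open>T0\<close> occurs in \<open>T\<close>.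
  Tested on patches of two tiles, a period of \<open>T\<close> therefore becomes a period of
  \<open>T0\<close>.\<close>

lemma tiling_space_not_periodic:
  assumes "tiling_space \<Omega>" "T \<in> \<Omega>"
  shows "\<not> periodic T"
proof -
  from tiling_spaceE[OF assms(1)] obtain T0 where
    T0: "tiling T0" and rep: "repetitive T0" and np: "\<not> periodic T0" and
    \<Omega>: "\<Omega> = {T. tiling T \<and> (\<forall>R. \<exists>s. agree_on {-R..R} T (translate T0 s))}" .
  have T: "tiling T" "\<And>R. \<exists>s. agree_on {-R..R} T (translate T0 s)"
    using assms(2)[unfolded \<Omega>] by blast+
  have patch: "\<exists>s. translate P s \<subseteq> T" if P: "finite P" "P \<subseteq> T0" for P
  proof -
    from rep[unfolded repetitive_def, rule_format, OF conjI[OF P]]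
    obtain L where L: "L > 0"
      "\<forall>a. \<exists>s. translate P s \<subseteq> T0 \<and> (\<forall>t\<in>translate P s. fst t \<subseteq> {a..a + L})"
      by metis
    \<comment> \<open>A copy of \<open>P\<close> that \<open>T0\<close> has inside [q, q + L] moves
      to [0, L] in \<open>translate T0 q\<close>, hence into the window where \<open>T\<close>
      agrees with it.\<close>
    obtain q where q: "agree_on {-L..L} T (translate T0 q)" using T(2) by metis
    obtain s where s: "translate P s \<subseteq> T0" "\<And>t. t \<in> translate P s \<Longrightarrow> fst t \<subseteq> {q..q + L}"
      using L(2) by metis
    have "translate P (s + q) \<subseteq> T"
    proof
      fix t assume "t \<in> translate P (s + q)"
      then have t: "t \<in> translate (translate P s) q" by simp
      have t': "t \<in> translate T0 q" using t translate_mono[OF s(1)] by blast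
      from mem_translateE[OF T0 t'] obtain a b l
        where ab: "a < b" "t = ({a - q..b - q}, l)" "({a..b}, l) \<in> T0" .
      have "({a..b}, l) \<in> translate P s"
        using t unfolding ab(2) mem_translate_iff[of _ _ _ q]
        using image_minus_Icc[of "- q" "a - q" "b - q"] by simp
      from s(2)[OF this] have "a - q \<in> {a - q..b - q} \<inter> {-L..L}"
        using ab(1) L(1) by auto
      then have "fst t \<inter> {-L..L} \<noteq> {}" unfolding ab(2) fst_conv by blast
      then show "t \<in> T" using q t' unfolding agree_on_def by blast
    qed
    then show ?thesis ..
  qed
  have sub: "translate T0 p \<subseteq> T0" if p: "translate T p = T" for p
  proof
    fix t assume t: "t \<in> translate T0 p"
    from mem_translateE[OF T0 t] obtain a b l
      where ab: "a < b" "t = ({a - p..b - p}, l)" "({a..b}, l) \<in> T0" .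
    \<comment> \<open>\<open>m\<close> is the midpoint of \<open>t\<close>, and \<open>u\<close> is
      the tile of \<open>T0\<close> covering it. A copy in \<open>T\<close> of the patch formed by
      \<open>u\<close> and the tile that \<open>t\<close> comes from is moved by the period: the
      copy of \<open>t\<close> so obtained is in \<open>T\<close> and has an interior point in the
      copy of \<open>u\<close>, so the two coincide.\<close>
    define m where "m = (a + b) / 2 - p"
    have m: "a - p < m" "m < b - p" using ab(1) by (auto simp: m_def)
    obtain u where u: "u \<in> T0" "m \<in> fst u" using tiling_cover[OF T0] .
    obtain c d k where cd: "u = ({c..d}, k)"
      using tiling_tileE[OF T0] u(1) by (metis surj_pair)
    obtain s where s: "translate {({a..b}, l), u} s \<subseteq> T" using patch[of "{({a..b}, l), u}"] u ab by blast
    have st: "({a - s..b - s}, l) \<in> T" and su: "({c - s..d - s}, k) \<in> T"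
      using s by (auto simp: translate_def cd image_minus_Icc)
    have "({a - s - p..b - s - p}, l) \<in> translate T p"
      unfolding mem_translate_iff using st image_minus_Icc[of "- p"] by simp
    then have "({a - s - p..b - s - p}, l) \<in> T" by (simp only: p)
    from tiling_meet_interior[OF T(1) this su, of "m - s"]
    have "({c - s..d - s}, k) = ({a - s - p..b - s - p}, l)" using m u(2) cd by simp
    \<comment> \<open>Nondegeneracy makes equality of the intervals give equality of their
      endpoints.\<close>
    moreover have "a - s - p < b - s - p" using ab(1) by simp
    ultimately have "t = u" unfolding ab(2) cd by (simp add: Icc_eq_Icc)
    then show "t \<in> T0" using u(1) by simp
  qed
  show ?thesis
  proof
    assume "periodic T"
    then obtain p where p: "p \<noteq> 0" "translate T p = T" unfolding periodic_def by blast
    \<comment> \<open>The period -p supplies the reverse inclusion.\<close>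
    have "translate T (- p) = T" using translate_translate[of T p "- p"] p(2) by simp
    from sub[OF this] have "translate (translate T0 (- p)) p \<subseteq> translate T0 p"
      by (rule translate_mono)
    then have "translate T0 p = T0" using sub[OF p(2)] by simp
    then show False using np p(1) unfolding periodic_def by blast
  qed
qed

text \<open>Makes the orbit parameter unique, so that two descriptions of the same motion along an
  orbit can be compared.\<close>

lemma tiling_space_translate_inj:
  assumes "tiling_space \<Omega>" "T \<in> \<Omega>" "translate T r = translate T s"
  shows "r = s"
proof -
  have "translate T (r - s) = T"
    using translate_translate[of T r "- s"] translate_translate[of T s "- s"] assms(3) by simp
  then show ?thesis
    using tiling_space_not_periodic[OF assms(1,2)] unfolding periodic_def
    by (metis eq_iff_diff_eq_0)
qed

section \<open>Signs and iterates on the line\<close>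

lemma nonvanishing_constant_sign:
  fixes v :: "real \<Rightarrow> real"
  assumes "continuous_on UNIV v" "\<And>x. v x \<noteq> 0"
  shows "(\<forall>x. v x > 0) \<or> (\<forall>x. v x < 0)"
proof (rule ccontr)
  assume "\<not> ?thesis"
  then obtain a b where ab: "v a < 0" "v b > 0" using assms(2) by (metis linorder_neqE)
  have "connected (range v)"
    using connected_continuous_image[OF assms(1)] by simp
  then have "0 \<in> range v"
    using ab connectedD_interval[of "range v" "v a" "v b" 0] by auto
  then show False using assms(2) by (metis imageE)
qed

text \<open>Negative iterates are powers of \<open>inv f\<close>; surjectivity gives
  \<open>f (inv f y) = y\<close>, so \<open>inv f\<close> lowers \<open>H\<close> by 1.\<close>

lemma int_iterate_conjugate_shift:
  fixes H :: "'b \<Rightarrow> real"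
  assumes step: "\<And>x. H (f x) = H x + 1" and surj: "surj f"
  shows "H (int_iterate f n x) = H x + of_int n"
proof -
  have "H ((f ^^ k) x) = H x + real k" for k
    by (induction k) (auto simp: step)
  moreover have "H (inv f y) = H y - 1" for y
    using step[of "inv f y"] surj_f_inv_f[OF surj, of y] by simp
  then have "H ((inv f ^^ k) x) = H x - real k" for k
    by (induction k) auto
  ultimately show ?thesis by (simp add: int_iterate_def)
qed

section \<open>The time form as a rotation form\<close>

theorem theorem1:
  fixes \<Omega> :: "'a::finite tile set set"
    and F :: "'a tile set \<Rightarrow> 'a tile set"
    and T :: "'a tile set"
  assumes "tiling_space \<Omega>"
    and "uniquely_ergodic \<Omega>"
    and "F \<in> sPE_homeos \<Omega>"
    and "\<exists>Fbar V. sPE_flow \<Omega> Fbar V \<and> unidirectional \<Omega> V \<and> time_one_sampling \<Omega> F Fbar"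
    and "\<forall>T'\<in>\<Omega>. F T' \<noteq> T'"
    and "T \<in> \<Omega>"
  shows "\<exists>\<mu>. rotation_form F T \<mu>"
proof -
  obtain Fbar V where flow: "sPE_flow \<Omega> Fbar V" and uni: "unidirectional \<Omega> V"
    and smp: "time_one_sampling \<Omega> F Fbar" using assms(4) by blast
  obtain \<xi> where \<xi>: "\<And>T. T \<in> \<Omega> \<Longrightarrow> \<xi> T 0 = 0"
    "\<And>T t. T \<in> \<Omega> \<Longrightarrow> Fbar (T, t) = translate T (\<xi> T t)"
    "\<And>T t. T \<in> \<Omega> \<Longrightarrow> (\<xi> T has_real_derivative V (translate T (\<xi> T t))) (at t)"
    using flow unfolding sPE_flow_def by blast
  have orbit: "translate T x \<in> \<Omega>" for x
    using tiling_space_translate assms(1,6) .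
  define v where "v = (\<lambda>x. V (translate T x))"
  define f where "f = orbit_map F T"
  \<comment> \<open>In the coordinate x of \<open>translate T x\<close>, \<open>z y\<close> is the
    flow line that starts at \<open>y\<close>.\<close>
  define z where "z = (\<lambda>y t. y + \<xi> (translate T y) t)"
  have v0: "v x \<noteq> 0" for x
    using uni orbit unfolding unidirectional_def v_def by blast
  have "sPE T v"
    using flow assms(6) unfolding sPE_flow_def sPE_on_def v_def by blast
  then obtain R where vc: "continuous_on UNIV v" and R: "R > 0"
    "\<And>x1 x2. agree_on {-R..R} (translate T x1) (translate T x2) \<Longrightarrow> v x1 = v x2"
    unfolding sPE_def by blast
  have gc: "continuous_on UNIV (\<lambda>x. 1 / v x)"
    by (intro continuous_intros vc) (use v0 in auto)
  \<comment> \<open>Infinite endpoints give a single primitive on the whole line.\<close>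
  have "\<exists>H. \<forall>x. - \<infinity> < ereal x \<longrightarrow> ereal x < \<infinity> \<longrightarrow> (H has_vector_derivative 1 / v x) (at x)"
    by (rule einterval_antiderivative) (use gc in \<open>auto simp: continuous_on_eq_continuous_at\<close>)
  then obtain H where H: "\<And>x. (H has_real_derivative 1 / v x) (at x)"
    by (auto simp: has_real_derivative_iff_has_vector_derivative)
  have H_int: "(LBINT x=ereal x1..ereal x2. 1 / v x) = H x2 - H x1" for x1 x2
  proof (rule interval_integral_FTC_finite)
    show "continuous_on {min x1 x2..max x1 x2} (\<lambda>x. 1 / v x)"
      using gc continuous_on_subset by blast
    show "(H has_vector_derivative 1 / v x) (at x within {min x1 x2..max x1 x2})" for x
      using H[of x] by (simp add: has_real_derivative_iff_has_vector_derivative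
          has_vector_derivative_at_within)
  qed
  \<comment> \<open>Along a flow line the derivative of \<open>H\<close> is v / v = 1, so
    \<open>H (z y t) - t\<close> keeps its value \<open>H y\<close> at t = 0.\<close>
  have Hz: "H (z y t) = H y + t" for y t
  proof -
    have dz: "(z y has_real_derivative v (z y t)) (at t)" for t
      using \<xi>(3)[OF orbit, of y t] unfolding z_def v_def
      by (auto intro!: derivative_eq_intros simp: add.commute)
    have "((\<lambda>t. H (z y t) - t) has_real_derivative 0) (at t)" for t
      by (rule derivative_eq_intros DERIV_chain2[OF H dz] refl)+ (simp add: v0)
    from DERIV_isconst_all[OF allI[OF this], of t 0] show ?thesis
      using \<xi>(1)[OF orbit] by (simp add: z_def)
  qed
  have "f y = z y 1" for y
  proof -
    have "F (translate T y) = translate (translate T y) (\<xi> (translate T y) 1)"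
      using smp \<xi>(2)[OF orbit] orbit unfolding time_one_sampling_def by metis
    moreover have "F (translate T y) = translate (translate T y) (displacement F (translate T y))"
      using assms(3) orbit unfolding sPE_homeos_def by blast
    ultimately have "displacement F (translate T y) = \<xi> (translate T y) 1"
      using tiling_space_translate_inj[OF assms(1) orbit] by metis
    then show ?thesis by (simp add: f_def orbit_map_def z_def)
  qed
  then have step: "H (f y) = H y + 1" for y using Hz by simp
  have "(\<forall>x. v x > 0) \<or> (\<forall>x. v x < 0)"
    using nonvanishing_constant_sign vc v0 by blast
  then have mono: "strict_mono H \<or> strict_antimono_on UNIV H"
  proof
    assume "\<forall>x. v x > 0"
    then have "H a < H b" if "a < b" for a b
      using DERIV_pos_imp_increasing[OF that] H by (metis zero_less_divide_1_iff)
    then show ?thesis by (simp add: strict_mono_def)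
  next
    assume "\<forall>x. v x < 0"
    then have "H b < H a" if "a < b" for a b
      using DERIV_neg_imp_decreasing[OF that] H by (metis divide_less_0_1_iff)
    then show ?thesis by (simp add: monotone_on_def)
  qed
  \<comment> \<open>Increasing and decreasing \<open>H\<close> correspond to the two disjuncts of
    \<open>strictly_between\<close>.\<close>
  then have btw: "strictly_between y a b" if "H a < H y" "H y < H b" for y a b
    using that unfolding strictly_between_def strict_mono_def monotone_on_def
    by (metis UNIV_I linorder_less_linear order_less_asym)
  have injH: "x = y" if "H x = H y" for x y
    using mono that unfolding strict_mono_def monotone_on_def
    by (metis UNIV_I linorder_less_linear less_irrefl)
  \<comment> \<open>Flowing backwards for unit time gives a preimage under \<open>f\<close>: both
    sides have the same value of \<open>H\<close>.\<close>
  have "f (z y (- 1)) = y" for y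
    by (rule injH) (simp add: step Hz)
  then have "surj f" by (rule surjI)
  note iter = int_iterate_conjugate_shift[of H f, OF step this]
  have "rotation_form F T (\<lambda>x. 1 / v x)"
    unfolding rotation_form_def sPE_def H_int f_def[symmetric]
  \<comment> \<open>The radius \<open>R\<close> of \<open>v\<close> is the witness for both radii.
    In terms of \<open>H\<close>, betweenness reads H x1 + m < H x2 < H x1 + n.\<close>
  proof (intro conjI exI[of _ R] allI impI)
    show "continuous_on UNIV (\<lambda>x. 1 / v x)" by (rule gc)
  next
    fix x1 x2 m n
    assume "of_int m < H x2 - H x1 \<and> H x2 - H x1 < of_int n"
    then show "strictly_between x2 (int_iterate f m x1) (int_iterate f n x1)"
      by (intro btw) (auto simp: iter)
  qed (use R in auto)
  then show ?thesis by blast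
qed

end
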